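(* Let $p$ be a prime and let $G$ be a finitely generated group with a presentation $Q=\langle X\mid R\rangle$, where $X$ is finite and freely generates the non-abelian free group $F_n$ of rank $n$, and $R\subseteq F_n$ is a disjoint union $R=S_1\cup S_2\cup S_3$ such that: (i) $S_1=\{w_1,\ldots,w_r\}$ is a finite set of elements of $F_n$ which are not proper $p$-powers (i.e. not $p$-th powers of elements of $F_n$); (ii) $S_2$ is a (possibly infinite) set of elements of $F_n$ of the form $v^{p^a}$ with $v\in F_n$, $a>0$, such that the order $o(\psi(v),G/R_G)$ of $\psi(v)$ in $G/R_G$ is exactly $p^a$; (iii) $S_3$ is a (possibly infinite) set of elements of $F_n$ of the form $u^{p^b}$ with $u\in F_n$, $b>0$, such that $o(\psi(u),G/R_G)<p^b$. Let $S=S_1\cup S_2$ and let $P=\langle X\mid S\rangle$. If $def_p(P)>1$, then $RG(G)>0$.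
   Context: $R_G$ denotes the finite residual of $G$, i.e. the intersection of all finite index subgroups of $G$, and $G/R_G$ is the residual quotient. $\psi:F_n\to G/R_G$ is the composition of the canonical map $F_n\to G$ induced by the presentation $Q$ with the canonical map $G\to G/R_G$. For $r\in F_n$ let $\nu_p(r)$ be the largest integer $k\ge 0$ such that $r=s^{p^k}$ for some $s\in F_n$ (relators are understood to be nontrivial elements of $F_n$, so this is well defined). The $p$-deficiency of a presentation $P=\langle X\mid S\rangle$ with $X$ freely generating $F_n$ is $$def_p(P)=n-\sum_{r\in S}p^{-\nu_p(r)}$$ (equal to $-\infty$ if the sum diverges). The rank gradient of a finitely generated group $G$ is $$RG(G)=\inf_{H}\frac{d(H)-1}{|G:H|},$$ where $H$ ranges over all finite index subgroups of $G$ and $d(H)$ is the minimal number of generators of $H$. *)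

theory Defs
  imports
    "HOL-Algebra.Generated_Groups"
    "HOL-Algebra.Multiplicative_Group"
    "HOL-Analysis.Infinite_Sum"
    "HOL-Library.Extended_Real"
begin

section \<open>Free groups\<close>

text \<open>A letter \<open>(x, True)\<close> stands for the generator \<open>x\<close>, a letter \<open>(x, False)\<close> for its inverse.
  The free group on \<open>X\<close> consists of the reduced words in these letters.\<close>

type_synonym 'x word = "('x \<times> bool) list"

definition flip :: "'x \<times> bool \<Rightarrow> 'x \<times> bool" where
  "flip a = (fst a, \<not> snd a)"

definition reduced :: "'x word \<Rightarrow> bool" where
  "reduced w \<longleftrightarrow> successively (\<lambda>a b. b \<noteq> flip a) w"

fun cons_red :: "'x \<times> bool \<Rightarrow> 'x word \<Rightarrow> 'x word" where
  "cons_red a [] = [a]"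
| "cons_red a (b # w) = (if b = flip a then w else a # b # w)"

definition reduce :: "'x word \<Rightarrow> 'x word" where
  "reduce w = foldr cons_red w []"

definition free_group :: "'x set \<Rightarrow> 'x word monoid" where
  "free_group X =
    \<lparr>carrier = {w. fst ` set w \<subseteq> X \<and> reduced w},
     monoid.mult = (\<lambda>u v. reduce (u @ v)),
     monoid.one = []\<rparr>"

lemma flip_flip [simp]: "flip (flip a) = a"
  by (simp add: flip_def)

lemma fst_flip [simp]: "fst (flip a) = fst a"
  by (simp add: flip_def)

lemma reduced_Nil [simp]: "reduced []"
  by (simp add: reduced_def)

lemma reduced_ConsD: "reduced (a # w) \<Longrightarrow> reduced w"
  by (cases w) (auto simp: reduced_def)

lemma reduced_cons_red: "reduced w \<Longrightarrow> reduced (cons_red a w)"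
  by (cases w) (auto simp: reduced_def dest: reduced_ConsD[unfolded reduced_def])

lemma reduced_foldr: "reduced w \<Longrightarrow> reduced (foldr cons_red u w)"
  by (induction u) (auto intro: reduced_cons_red)

lemma cons_red_flip: "reduced w \<Longrightarrow> cons_red (flip a) (cons_red a w) = w"
proof (cases w)
  case (Cons b v)
  assume "reduced w"
  with Cons show ?thesis by (cases v) (auto simp: reduced_def)
qed simp

lemma cons_red_flip': "reduced w \<Longrightarrow> cons_red a (cons_red (flip a) w) = w"
  using cons_red_flip[of w "flip a"] by simp

lemma foldr_cons_red:
  "reduced w \<Longrightarrow> foldr cons_red (cons_red a u) w = cons_red a (foldr cons_red u w)"
  by (cases u) (auto simp: cons_red_flip' reduced_foldr)

lemma foldr_foldr:
  "reduced w \<Longrightarrow>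
    foldr cons_red (foldr cons_red u v) w = foldr cons_red u (foldr cons_red v w)"
  by (induction u) (auto simp: foldr_cons_red)

lemma reduce_reduced: "reduced w \<Longrightarrow> reduce w = w"
proof (induction w)
  case (Cons a w)
  then show ?case by (cases w) (auto simp: reduce_def reduced_def)
qed (simp add: reduce_def)

lemma reduce_append: "reduced v \<Longrightarrow> reduce (u @ v) = foldr cons_red u v"
  using reduce_reduced[of v] by (simp add: reduce_def)

lemma foldr_inverse:
  "reduced z \<Longrightarrow> foldr cons_red (rev (map flip w)) (foldr cons_red w z) = z"
  by (induction w arbitrary: z) (auto simp: cons_red_flip reduced_foldr)

lemma set_cons_red: "set (cons_red a w) \<subseteq> insert a (set w)"
  by (cases w) auto

lemma set_foldr: "set (foldr cons_red u w) \<subseteq> set u \<union> set w"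
  by (induction u) (use set_cons_red in fastforce)+

lemma fst_foldr:
  assumes "fst ` set u \<subseteq> X" "fst ` set w \<subseteq> X"
  shows "fst ` set (foldr cons_red u w) \<subseteq> X"
  using image_mono[OF set_foldr[of u w], of fst] assms by (simp add: image_Un) blast

lemma group_free_group: "group (free_group X)"
proof (rule groupI)
  fix u v assume "u \<in> carrier (free_group X)" "v \<in> carrier (free_group X)"
  then show "u \<otimes>\<^bsub>free_group X\<^esub> v \<in> carrier (free_group X)"
    using fst_foldr[of u X v] by (simp add: free_group_def reduce_append reduced_foldr)
next
  fix u v w
  assume "u \<in> carrier (free_group X)" "v \<in> carrier (free_group X)" "w \<in> carrier (free_group X)"
  then show "u \<otimes>\<^bsub>free_group X\<^esub> v \<otimes>\<^bsub>free_group X\<^esub> w =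
      u \<otimes>\<^bsub>free_group X\<^esub> (v \<otimes>\<^bsub>free_group X\<^esub> w)"
    by (simp add: free_group_def reduce_append reduced_foldr foldr_foldr)
next
  fix u assume u: "u \<in> carrier (free_group X)"
  let ?v = "reduce (rev (map flip u))"
  have "?v \<in> carrier (free_group X)"
    using u fst_foldr[of "rev (map flip u)" X "[]"]
    by (simp add: free_group_def reduce_def reduced_foldr image_image)
  moreover have "?v \<otimes>\<^bsub>free_group X\<^esub> u = \<one>\<^bsub>free_group X\<^esub>"
    using u foldr_inverse[of "[]" u] reduce_reduced[of u]
    by (simp add: free_group_def reduce_append foldr_foldr) (simp add: reduce_def foldr_foldr)
  ultimately show "\<exists>v\<in>carrier (free_group X). v \<otimes>\<^bsub>free_group X\<^esub> u = \<one>\<^bsub>free_group X\<^esub>"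
    by blast
qed (auto simp: free_group_def reduce_append reduce_reduced)


section \<open>Presentations\<close>

definition normal_closure :: "('a, 'b) monoid_scheme \<Rightarrow> 'a set \<Rightarrow> 'a set" where
  "normal_closure G R = \<Inter>{N. N \<lhd> G \<and> R \<subseteq> N}"

text \<open>\<open>G\<close> has the presentation \<open>\<langle>X | R\<rangle>\<close>, with \<open>\<pi>\<close> the canonical map from the free group on \<open>X\<close>.\<close>

definition presents ::
  "'x set \<Rightarrow> 'x word set \<Rightarrow> ('g, 'b) monoid_scheme \<Rightarrow> ('x word \<Rightarrow> 'g) \<Rightarrow> bool" where
  "presents X R G \<pi> \<longleftrightarrow>
     R \<subseteq> carrier (free_group X) \<and>
     \<pi> \<in> hom (free_group X) G \<and>
     \<pi> ` carrier (free_group X) = carrier G \<and>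
     kernel (free_group X) G \<pi> = normal_closure (free_group X) R"


section \<open>The p-deficiency\<close>

definition nu :: "nat \<Rightarrow> 'x set \<Rightarrow> 'x word \<Rightarrow> nat" where
  "nu p X r = (GREATEST k. \<exists>s\<in>carrier (free_group X). r = s [^]\<^bsub>free_group X\<^esub> (p ^ k))"

definition p_deficiency :: "nat \<Rightarrow> 'x set \<Rightarrow> 'x word set \<Rightarrow> ereal" where
  "p_deficiency p X S =
     (if (\<lambda>r. 1 / real p ^ nu p X r) summable_on S
      then ereal (real (card X) - (\<Sum>\<^sub>\<infinity>r\<in>S. 1 / real p ^ nu p X r))
      else -\<infinity>)"


section \<open>Finite residual and rank gradient\<close>

definition finite_index_subgroup :: "'g set \<Rightarrow> ('g, 'b) monoid_scheme \<Rightarrow> bool" where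
  "finite_index_subgroup H G \<longleftrightarrow> subgroup H G \<and> finite (rcosets\<^bsub>G\<^esub> H)"

definition finite_residual :: "('g, 'b) monoid_scheme \<Rightarrow> 'g set" where
  "finite_residual G = \<Inter>{H. finite_index_subgroup H G}"

definition finitely_generated :: "('g, 'b) monoid_scheme \<Rightarrow> bool" where
  "finitely_generated G \<longleftrightarrow> (\<exists>A\<subseteq>carrier G. finite A \<and> generate G A = carrier G)"

definition min_gens :: "('g, 'b) monoid_scheme \<Rightarrow> nat" where
  "min_gens G = (LEAST k. \<exists>A\<subseteq>carrier G. finite A \<and> card A = k \<and> generate G A = carrier G)"

definition rank_gradient :: "('g, 'b) monoid_scheme \<Rightarrow> real" where
  "rank_gradient G =
     (INF H\<in>{H. finite_index_subgroup H G}.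
        (real (min_gens (G\<lparr>carrier := H\<rparr>)) - 1) / real (card (rcosets\<^bsub>G\<^esub> H)))"

text \<open>The order of the image of \<open>g\<close> in the residual quotient of \<open>G\<close>; as for \<^const>\<open>group.ord\<close>,
  the value 0 means infinite order.\<close>

definition residual_ord :: "('g, 'b) monoid_scheme \<Rightarrow> 'g \<Rightarrow> nat" where
  "residual_ord G g = group.ord (G Mod finite_residual G) (finite_residual G #>\<^bsub>G\<^esub> g)"

end

theory Submission
  imports Defs
begin

text \<open>Let \<open>H\<close> have finite index \<open>m\<close> in \<open>G\<close> and be generated by \<open>d\<close> elements. Label the \<open>m n\<close> edges of the
  Schreier graph of \<open>H\<close> by residues mod \<open>p\<close>; path sums of labels form a cocycle on the free group.
  If the sums along all relators vanish, they induce a homomorphism from \<open>H\<close> to \<open>\<int>/p\<close>, determined by its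
  \<open>d\<close> values on generators, and the labels are then determined by \<open>m - 1\<close> further sums along paths
  reaching the other vertices. A relator \<open>s ^ p ^ k\<close> gives one condition per orbit of \<open>s\<close> of length
  exactly \<open>p ^ k\<close>, because on a shorter orbit its path is a closed path traversed a multiple of \<open>p\<close>
  times; so it gives at most \<open>m / p ^ k\<close> conditions, and relators from \<open>S3\<close> give none. Hence
  \<open>m n \<le> d + (m - 1) + m \<Sigma>\<close>, where \<open>\<Sigma>\<close> is the sum in the \<open>p\<close>-deficiency, which is
  \<open>(d - 1) / m \<ge> n - \<Sigma> - 1\<close>.\<close>

section \<open>Right cosets, generators and the finite residual\<close>

lemma (in group)
  assumes "subgroup H G" "c \<in> rcosets H"
  shows rcosets_act_closed: "g \<in> carrier G \<Longrightarrow> c #> g \<in> rcosets H"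
    and rcosets_act_one: "c #> \<one> = c"
    and rcosets_act_mult:
      "\<lbrakk>g \<in> carrier G; h \<in> carrier G\<rbrakk> \<Longrightarrow> c #> (g \<otimes> h) = c #> g #> h"
proof -
  have c: "c \<subseteq> carrier G"
    using assms subgroup.rcosets_carrier is_group by blast
  show "c #> \<one> = c"
    using c by (rule coset_mult_one)
  show "c #> (g \<otimes> h) = c #> g #> h" if "g \<in> carrier G" "h \<in> carrier G"
    using c that by (simp add: coset_mult_assoc)
  obtain a where a: "a \<in> carrier G" "c = H #> a"
    using assms(2) by (auto simp: RCOSETS_def)
  show "c #> g \<in> rcosets H" if "g \<in> carrier G"
    using a that assms(1) by (simp add: coset_mult_assoc rcosetsI subgroup.subset)
qed

lemma (in group) base_in_rcosets: "subgroup H G \<Longrightarrow> H \<in> rcosets H"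
  using coset_mult_one[of H] rcosetsI[of H \<one>] by (simp add: subgroup.subset)

lemma (in group) rcosets_act_fixed_mult:
  assumes "subgroup H G" "c \<in> rcosets H" "g \<in> carrier G" "c #> g [^] (t::nat) = c"
  shows "c #> g [^] (t * q) = c"
proof (induction q)
  case 0
  then show ?case using assms by (simp add: rcosets_act_one)
next
  case (Suc q)
  have "c #> g [^] (t * Suc q) = c #> g [^] t #> g [^] (t * q)"
    using assms by (simp add: nat_pow_mult[symmetric] rcosets_act_mult)
  then show ?case using assms Suc by simp
qed

text \<open>Bezout in the form \<open>t * x = N * y + gcd t N\<close> stays within natural
  exponents; this form requires \<open>t > 0\<close>.\<close>

lemma (in group) rcosets_act_fixed_gcd:
  assumes "subgroup H G" "c \<in> rcosets H" "g \<in> carrier G" "t > 0"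
    and t: "c #> g [^] (t::nat) = c" and N: "c #> g [^] (N::nat) = c"
  shows "c #> g [^] gcd t N = c"
proof -
  obtain x y where xy: "t * x = N * y + gcd t N"
    using bezout_nat[of t N] assms(4) by auto
  have "c = c #> g [^] (t * x)"
    using rcosets_act_fixed_mult[OF assms(1-3) t] by simp
  also have "\<dots> = c #> g [^] (N * y) #> g [^] gcd t N"
    using assms unfolding xy by (simp add: nat_pow_mult[symmetric] rcosets_act_mult)
  also have "\<dots> = c #> g [^] gcd t N"
    using rcosets_act_fixed_mult[OF assms(1-3) N] by simp
  finally show ?thesis by simp
qed

text \<open>Schreier's lemma: with a transversal \<open>\<tau>\<close>, the elements
  \<open>\<tau> c a (\<tau> (c a))\<inverse>\<close> generate \<open>H\<close>.\<close>

lemma (in group) finite_index_finitely_generated: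
  assumes H: "subgroup H G" and fin: "finite (rcosets H)"
    and A: "A \<subseteq> carrier G" "finite A" "generate G A = carrier G"
  obtains B where "B \<subseteq> H" "finite B" "generate G B = H"
proof -
  \<comment> \<open>Choosing \<open>\<one>\<close> for the coset \<open>H\<close> makes
    \<open>s H h = h\<close> for every \<open>h\<close> in \<open>H\<close>, which is how
    \<open>H\<close> is finally caught inside \<open>generate G B\<close>.\<close>
  define \<tau> where "\<tau> c = (if c = H then \<one> else SOME g. g \<in> carrier G \<and> H #> g = c)" for c
  have \<tau>: "\<tau> c \<in> carrier G \<and> H #> \<tau> c = c" if c: "c \<in> rcosets H" for c
  proof (cases "c = H")
    case True
    then show ?thesis using H by (simp add: \<tau>_def subgroup.subset)
  next
    case False
    have "\<exists>g. g \<in> carrier G \<and> H #> g = c" using c by (auto simp: RCOSETS_def)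
    from someI_ex[OF this] show ?thesis using False by (simp add: \<tau>_def)
  qed
  note cl = rcosets_act_closed[OF H]
  define s where "s c g = \<tau> c \<otimes> g \<otimes> inv (\<tau> (c #> g))" for c g
  have sH: "s c g \<in> H" if c: "c \<in> rcosets H" and g: "g \<in> carrier G" for c g
  proof -
    have "H #> (\<tau> c \<otimes> g) = c #> g"
      using \<tau>[OF c] g H by (metis coset_mult_assoc subgroup.subset)
    then have "\<tau> c \<otimes> g \<in> H #> \<tau> (c #> g)"
      using \<tau>[OF c] \<tau>[OF cl[OF c g]] g H rcos_self[of "\<tau> c \<otimes> g" H] by simp
    then show ?thesis
      unfolding s_def using \<tau>[OF cl[OF c g]] H is_group by (blast intro: subgroup.rcos_module_imp)
  qed
  \<comment> \<open>The inner factors \<open>\<tau> (c #> g)\<close> cancel. Hence a word in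
    \<open>A\<close> read from \<open>c\<close> splits into Schreier elements read from the
    successive cosets.\<close>
  have s_mult: "s c (g \<otimes> h) = s c g \<otimes> s (c #> g) h"
    if c: "c \<in> rcosets H" and g: "g \<in> carrier G" and h: "h \<in> carrier G" for c g h
  proof -
    have "\<tau> c \<in> carrier G" "\<tau> (c #> g) \<in> carrier G" "\<tau> (c #> g #> h) \<in> carrier G"
      using \<tau> cl c g h by blast+
    moreover from this g have "inv (\<tau> (c #> g)) \<otimes> (\<tau> (c #> g) \<otimes> x) = x" if "x \<in> carrier G" for x
      using that by (simp add: m_assoc[symmetric])
    ultimately show ?thesis
      using g h c rcosets_act_mult[OF H c g h] by (simp add: s_def m_assoc)
  qed
  define B where "B = (\<lambda>(c, a). s c a) ` ((rcosets H) \<times> A)"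
  have "s c g \<in> generate G B" if "g \<in> generate G A" "c \<in> rcosets H" for c g
    using that
  proof (induction g arbitrary: c)
    case one
    have "s c \<one> = \<one>"
      using one \<tau>[of c] rcosets_act_one[OF H one] by (simp add: s_def)
    then show ?case by (simp add: generate.one)
  next
    case (incl a)
    then have "s c a \<in> B" by (auto simp: B_def)
    then show ?case by (rule generate.incl)
  next
    case (inv a)
    have a: "a \<in> carrier G" using inv A by blast
    let ?c = "c #> inv a"
    have c': "?c \<in> rcosets H" using cl[OF inv(2)] a by simp
    have "?c #> a = c"
      using rcosets_act_mult[OF H inv(2), of "inv a" a] a rcosets_act_one[OF H inv(2)] by simp
    \<comment> \<open>Reading \<open>inv a\<close> from \<open>c\<close> is reading \<open>a\<close>
      backwards from \<open>c #> inv a\<close>, so the result is the inverse of a member of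
      \<open>B\<close>.\<close>
    then have "s ?c a = inv (s c (inv a))"
      using a \<tau>[OF c'] \<tau>[OF inv(2)] by (simp add: s_def inv_mult_group m_assoc)
    moreover have "s c (inv a) \<in> carrier G"
      using sH[OF inv(2)] a H by (simp add: subgroup.mem_carrier)
    moreover have "s ?c a \<in> B" using inv c' by (auto simp: B_def)
    ultimately show ?case by (metis generate.inv inv_inv)
  next
    case (eng g h)
    have gh: "g \<in> carrier G" "h \<in> carrier G"
      using eng.hyps A by auto
    show ?case
      using s_mult[OF eng.prems gh] eng.IH(1)[OF eng.prems] eng.IH(2)[OF cl[OF eng.prems gh(1)]]
      by (simp add: generate.eng)
  qed
  note gen = this
  have "H \<subseteq> generate G B"
  proof
    fix h assume h: "h \<in> H"
    then have hG: "h \<in> carrier G" using H by (simp add: subgroup.mem_carrier)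
    have "s H h = h"
      using hG h H coset_join2[OF hG H h] by (simp add: s_def \<tau>_def)
    then show "h \<in> generate G B"
      using gen[of h H] A(3) hG base_in_rcosets[OF H] by simp
  qed
  moreover have BH: "B \<subseteq> H"
    using sH A(1) by (auto simp: B_def)
  moreover have "generate G B \<subseteq> H"
    using generate_subgroup_incl[OF BH H] .
  moreover have "finite B" using fin A(2) by (simp add: B_def)
  ultimately show thesis using that by blast
qed

text \<open>The \<open>LEAST\<close> in \<open>min_gens\<close> is a true minimum once some finite
  generating set exists, and Schreier's lemma provides one for \<open>H\<close>.\<close>

lemma (in group) min_gens_attained:
  assumes "finitely_generated G" "subgroup H G" "finite (rcosets H)"
  obtains B where "B \<subseteq> H" "finite B" "generate G B = H" "card B = min_gens (G\<lparr>carrier := H\<rparr>)"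
proof -
  from assms(1) obtain A where "A \<subseteq> carrier G" "finite A" "generate G A = carrier G"
    by (auto simp: finitely_generated_def)
  with assms obtain B where "B \<subseteq> H" "finite B" "generate G B = H"
    using finite_index_finitely_generated by metis
  then have "\<exists>k. \<exists>A\<subseteq>carrier (G\<lparr>carrier := H\<rparr>). finite A \<and> card A = k \<and>
      generate (G\<lparr>carrier := H\<rparr>) A = carrier (G\<lparr>carrier := H\<rparr>)"
    using generate_consistent[of B H] assms(2) by auto
  then have "\<exists>A\<subseteq>carrier (G\<lparr>carrier := H\<rparr>). finite A \<and> card A = min_gens (G\<lparr>carrier := H\<rparr>) \<and>
      generate (G\<lparr>carrier := H\<rparr>) A = carrier (G\<lparr>carrier := H\<rparr>)"
    unfolding min_gens_def by (rule LeastI_ex)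
  then show thesis
    using that generate_consistent[OF _ assms(2)] by auto
qed

section \<open>Normality of the finite residual and its action on cosets\<close>

lemma (in group) finite_index_carrier: "finite_index_subgroup (carrier G) G"
  using coset_join2[OF _ subgroup_self]
  by (auto simp: finite_index_subgroup_def subgroup_self RCOSETS_def)

lemma (in group) finite_index_conjugate:
  assumes "finite_index_subgroup H G" and x: "x \<in> carrier G"
  shows "finite_index_subgroup ((\<lambda>h. inv x \<otimes> h \<otimes> x) ` H) G" (is "finite_index_subgroup ?K G")
proof -
  from assms(1) have H: "subgroup H G" and fin: "finite (rcosets H)"
    by (auto simp: finite_index_subgroup_def)
  note HG = subgroup.mem_carrier[OF H]
  have cancel: "x \<otimes> (inv x \<otimes> y) = y" if "y \<in> carrier G" for y
    using that x by (simp add: m_assoc[symmetric])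
  have "subgroup ?K G"
  proof (rule subgroupI)
    show "?K \<subseteq> carrier G" "?K \<noteq> {}"
      using HG x H subgroup.one_closed by auto
    show "inv a \<in> ?K" if "a \<in> ?K" for a
    proof -
      from that obtain h where h: "h \<in> H" "a = inv x \<otimes> h \<otimes> x" by blast
      then have "inv a = inv x \<otimes> inv h \<otimes> x"
        using HG x by (simp add: inv_mult_group m_assoc)
      then show ?thesis using h H by (blast intro: subgroup.m_inv_closed)
    qed
    show "a \<otimes> b \<in> ?K" if "a \<in> ?K" "b \<in> ?K" for a b
    proof -
      from that obtain h k where h: "h \<in> H" "a = inv x \<otimes> h \<otimes> x"
        and k: "k \<in> H" "b = inv x \<otimes> k \<otimes> x" by blast
      then have "a \<otimes> b = inv x \<otimes> (h \<otimes> k) \<otimes> x"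
        using HG x cancel by (simp add: m_assoc)
      then show ?thesis using h k H by (blast intro: subgroup.m_closed)
    qed
  qed
  \<comment> \<open>With \<open>K = inv x H x\<close>, the coset \<open>K a\<close> is the left
    translate by \<open>inv x\<close> of \<open>H (x a)\<close>, so \<open>K\<close> has no more
    cosets than \<open>H\<close>.\<close>
  moreover have "rcosets ?K \<subseteq> (\<lambda>c. (\<lambda>y. inv x \<otimes> y) ` c) ` (rcosets H)"
  proof
    fix c assume "c \<in> rcosets ?K"
    then obtain a where a: "a \<in> carrier G" "c = ?K #> a" by (auto simp: RCOSETS_def)
    then have "c = (\<lambda>y. inv x \<otimes> y) ` (H #> (x \<otimes> a))"
      using HG x by (auto simp: r_coset_def m_assoc image_UN)
    moreover have "H #> (x \<otimes> a) \<in> rcosets H"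
      using H a x by (simp add: rcosetsI subgroup.subset)
    ultimately show "c \<in> (\<lambda>c. (\<lambda>y. inv x \<otimes> y) ` c) ` (rcosets H)" by blast
  qed
  ultimately show ?thesis
    using fin by (auto simp: finite_index_subgroup_def intro: finite_surj)
qed

text \<open>An element of the residual also lies in the finite index subgroup
  \<open>inv x H x\<close>, which puts its conjugate by \<open>x\<close> into
  \<open>H\<close>.\<close>

lemma (in group) finite_residual_normal: "finite_residual G \<lhd> G"
  unfolding normal_inv_iff
proof (intro conjI ballI)
  show "subgroup (finite_residual G) G"
    unfolding finite_residual_def using finite_index_carrier
    by (intro subgroups_Inter) (auto simp: finite_index_subgroup_def)
next
  fix x h assume x: "x \<in> carrier G" and h: "h \<in> finite_residual G"
  show "x \<otimes> h \<otimes> inv x \<in> finite_residual G"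
    unfolding finite_residual_def
  proof safe
    fix H assume H: "finite_index_subgroup H G"
    from h finite_index_conjugate[OF H x] obtain k where k: "k \<in> H" "h = inv x \<otimes> k \<otimes> x"
      by (auto simp: finite_residual_def)
    moreover from k H have "k \<in> carrier G"
      by (auto simp: finite_index_subgroup_def subgroup.mem_carrier)
    ultimately have "x \<otimes> h \<otimes> inv x = k"
      using x by (metis inv_closed inv_solve_left inv_solve_right m_assoc m_closed)
    then show "x \<otimes> h \<otimes> inv x \<in> H" using k by simp
  qed
qed

text \<open>The power lies in the finite residual. By normality so does its conjugate by a
  representative \<open>a\<close> of \<open>c\<close>, which is therefore in \<open>H\<close> and is
  absorbed by \<open>H a\<close>. For infinite order the exponent is 0 and the claim is
  trivial.\<close>

lemma (in group) residual_ord_fixes_rcosets: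
  assumes "finite_index_subgroup H G" "g \<in> carrier G" "c \<in> rcosets H"
  shows "c #> g [^] residual_ord G g = c"
proof -
  let ?N = "finite_residual G" and ?t = "residual_ord G g"
  interpret N: normal ?N G by (rule finite_residual_normal)
  interpret Q: group "G Mod ?N" by (rule N.factorgroup_is_group)
  from assms(1) have H: "subgroup H G" by (simp add: finite_index_subgroup_def)
  have gN: "?N #> g \<in> carrier (G Mod ?N)"
    using assms(2) by (auto simp: FactGroup_def RCOSETS_def)
  have pow: "(?N #> g) [^]\<^bsub>G Mod ?N\<^esub> (k::nat) = ?N #> g [^] k" for k
    using assms(2) by (induction k) (simp_all add: FactGroup_def N.rcos_sum N.subset)
  have "?N #> g [^] ?t = ?N"
    using Q.pow_ord_eq_1[OF gN] unfolding pow by (simp add: residual_ord_def)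
  then have t: "g [^] ?t \<in> ?N"
    by (rule coset_join1) (use assms(2) N.is_subgroup in auto)
  obtain a where a: "a \<in> carrier G" "c = H #> a"
    using assms(3) by (auto simp: RCOSETS_def)
  let ?h = "a \<otimes> g [^] ?t \<otimes> inv a"
  have "?h \<in> ?N" using t a by (simp add: N.inv_op_closed2)
  then have h: "?h \<in> H" using assms(1) by (auto simp: finite_residual_def)
  have "c #> g [^] ?t = H #> (?h \<otimes> a)"
    using a assms(2) H by (simp add: coset_mult_assoc subgroup.subset m_assoc)
  also have "\<dots> = c"
    using a assms(2) h H by (simp add: coset_mult_assoc[symmetric] subgroup.subset coset_join2)
  finally show ?thesis .
qed

section \<open>Cocycles on cosets\<close>

locale coset_hom = F: group F + G: group G + sub: subgroup H G
  for F (structure) and G (structure) and H +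
  fixes \<pi>
  assumes hom: "\<pi> \<in> hom F G"
begin

abbreviation cosets where "cosets \<equiv> rcosets\<^bsub>G\<^esub> H"

abbreviation act (infixl \<open>\<cdot>\<close> 60) where "c \<cdot> u \<equiv> c #>\<^bsub>G\<^esub> \<pi> u"

text \<open>A crossed homomorphism: \<open>D c u\<close> is the total label along the path spelled
  by \<open>u\<close> from the vertex \<open>c\<close>. Values are integers, and divisibility by
  \<open>p\<close> replaces vanishing in \<int>/p.\<close>

definition cocycle where
  "cocycle D \<longleftrightarrow> (\<forall>c\<in>cosets. \<forall>u\<in>carrier F. \<forall>v\<in>carrier F.
     (D c (u \<otimes> v) :: int) = D c u + D (c \<cdot> u) v)"

sublocale hm: group_hom F G \<pi>
  by unfold_locales (rule hom)

lemma base: "H \<in> cosets"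
  using G.base_in_rcosets sub.subgroup_axioms by blast

lemma act_closed: "\<lbrakk>c \<in> cosets; u \<in> carrier F\<rbrakk> \<Longrightarrow> c \<cdot> u \<in> cosets"
  by (simp add: G.rcosets_act_closed sub.subgroup_axioms)

lemma act_one: "c \<in> cosets \<Longrightarrow> c \<cdot> \<one> = c"
  by (simp add: G.rcosets_act_one[OF sub.subgroup_axioms])

lemma act_mult: "\<lbrakk>c \<in> cosets; u \<in> carrier F; v \<in> carrier F\<rbrakk> \<Longrightarrow> c \<cdot> (u \<otimes> v) = c \<cdot> u \<cdot> v"
  by (simp add: G.rcosets_act_mult[OF sub.subgroup_axioms])

lemma act_inv: "\<lbrakk>c \<in> cosets; u \<in> carrier F\<rbrakk> \<Longrightarrow> c \<cdot> u \<cdot> (inv u) = c"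
  using act_mult[of c u "inv u"] act_one[of c] by simp

lemma act_base_iff: "u \<in> carrier F \<Longrightarrow> H \<cdot> u = H \<longleftrightarrow> \<pi> u \<in> H"
  using G.coset_join1[of H "\<pi> u"] G.coset_join2[of "\<pi> u" H] sub.subgroup_axioms by auto

lemma cocycle_mult:
  "\<lbrakk>cocycle D; c \<in> cosets; u \<in> carrier F; v \<in> carrier F\<rbrakk> \<Longrightarrow>
    D c (u \<otimes> v) = D c u + D (c \<cdot> u) v"
  by (simp add: cocycle_def)

lemma cocycle_one: "\<lbrakk>cocycle D; c \<in> cosets\<rbrakk> \<Longrightarrow> D c \<one> = 0"
  using cocycle_mult[of D c \<one> \<one>] act_one[of c] by simp

lemma cocycle_inv:
  assumes "cocycle D" "c \<in> cosets" "u \<in> carrier F"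
  shows "D (c \<cdot> u) (inv u) = - D c u"
  using assms cocycle_mult[of D c u "inv u"] cocycle_one[of D c] by simp

lemma cocycle_pow:
  assumes "cocycle D" "c \<in> cosets" "u \<in> carrier F" "c \<cdot> u = c"
  shows "D c (u [^] (q::nat)) = int q * D c u"
proof (induction q)
  case 0
  then show ?case using assms by (simp add: cocycle_one)
next
  case (Suc q)
  have "D c (u [^] Suc q) = D c (u \<otimes> u [^] q)"
    using assms by (simp only: F.nat_pow_Suc2)
  then show ?case using assms Suc by (simp add: cocycle_mult algebra_simps)
qed

text \<open>Along an orbit of \<open>s\<close> shorter than \<open>p ^ k\<close>, the power \<open>s ^ p ^ k\<close> runs through
  the same closed path a multiple of \<open>p\<close> times.\<close>

lemma cocycle_dvd_of_short_orbit:
  assumes D: "cocycle D" and c: "c \<in> cosets" and s: "s \<in> carrier F"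
    and p: "prime p" and r: "c \<cdot> s [^] (p ^ k) = c"
    and t: "0 < t" "t < p ^ k" "c \<cdot> s [^] t = c"
  shows "int p dvd D c (s [^] (p ^ k))"
proof -
  \<comment> \<open>Passing from \<open>t\<close> to the gcd gives a period dividing
    \<open>p ^ k\<close>, hence \<open>p ^ j\<close>; \<open>d \<le> t < p ^ k\<close> forces
    \<open>j < k\<close>.\<close>
  define d where "d = gcd t (p ^ k)"
  have "c \<cdot> s [^] d = c"
    using G.rcosets_act_fixed_gcd[OF sub.subgroup_axioms c, of "\<pi> s" t "p ^ k"] s r t
    by (simp add: d_def hm.hom_nat_pow)
  moreover obtain j where j: "j \<le> k" "d = p ^ j"
    using divides_primepow_nat[OF p, of d k] by (auto simp: d_def)
  moreover have "d \<le> t" using t by (simp add: d_def gcd_le1_nat)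
  then have "j \<noteq> k" using t j by auto
  ultimately have jk: "j < k" and jfix: "c \<cdot> s [^] (p ^ j) = c" by auto
  have "s [^] (p ^ k) = (s [^] (p ^ j)) [^] (p ^ (k - j))"
    using s jk by (simp add: F.nat_pow_pow power_add[symmetric])
  then have "D c (s [^] (p ^ k)) = int (p ^ (k - j)) * D c (s [^] (p ^ j))"
    using cocycle_pow[OF D c _ jfix] s by simp
  moreover have "int p dvd int (p ^ (k - j))"
    using jk by simp
  ultimately show ?thesis by simp
qed

text \<open>Since \<open>s ^ i\<close> and \<open>s ^ N\<close> commute and \<open>s ^ N\<close>
  acts trivially, expanding the value of \<open>D c\<close> on their product in both orders gives
  the equality. Thus one base point per orbit suffices.\<close>

lemma cocycle_rotate:
  assumes D: "cocycle D" and c: "c \<in> cosets" and s: "s \<in> carrier F"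
    and r: "\<pi> (s [^] (N::nat)) = \<one>\<^bsub>G\<^esub>"
  shows "D (c \<cdot> s [^] (i::nat)) (s [^] N) = D c (s [^] N)"
proof -
  have "s [^] i \<otimes> s [^] N = s [^] N \<otimes> s [^] i"
    using s by (simp add: F.nat_pow_mult add.commute)
  moreover have "c \<cdot> s [^] N = c"
    using r act_one[OF c] by simp
  ultimately show ?thesis
    using cocycle_mult[OF D c, of "s [^] i" "s [^] N"] cocycle_mult[OF D c, of "s [^] N" "s [^] i"] s
    by simp
qed

text \<open>Only orbits of \<open>s\<close> of full length \<open>p ^ k\<close> impose a condition, and one per orbit.\<close>

lemma power_relator_conditions:
  assumes fin: "finite cosets" and p: "prime p" and s: "s \<in> carrier F"
    and r: "\<pi> (s [^] (p ^ k)) = \<one>\<^bsub>G\<^esub>"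
  shows "\<exists>B\<subseteq>cosets. p ^ k * card B \<le> card cosets \<and>
    (\<forall>D. cocycle D \<longrightarrow> (\<forall>c\<in>B. int p dvd D c (s [^] (p ^ k))) \<longrightarrow>
      (\<forall>c\<in>cosets. int p dvd D c (s [^] (p ^ k))))"
proof -
  \<comment> \<open>As \<open>s ^ p ^ k\<close> acts trivially, exponents below \<open>p ^ k\<close>
    already fill the orbit; its size is \<open>p ^ k\<close> exactly when they act on
    \<open>c\<close> injectively.\<close>
  define orb where "orb c = (\<lambda>i. c \<cdot> s [^] i) ` {..<p ^ k}" for c
  have triv: "c \<cdot> s [^] (p ^ k) = c" if "c \<in> cosets" for c
    using r act_one[OF that] by simp
  have pow: "c \<cdot> s [^] (i + j) = c \<cdot> s [^] i \<cdot> s [^] j" if "c \<in> cosets" for c and i j :: nat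
    using act_mult[OF that, of "s [^] i" "s [^] j"] s by (simp add: F.nat_pow_mult)
  have p0: "p ^ k > 0" using p by (simp add: prime_gt_0_nat)
  have mod: "c \<cdot> s [^] (i mod p ^ k) = c \<cdot> s [^] i" if c: "c \<in> cosets" for c i
  proof -
    have "c \<cdot> s [^] (p ^ k * (i div p ^ k)) = c"
      using G.rcosets_act_fixed_mult[OF sub.subgroup_axioms c, of "\<pi> s" "p ^ k"] triv[OF c] s
      by (simp add: hm.hom_nat_pow)
    with pow[OF c, of "p ^ k * (i div p ^ k)" "i mod p ^ k"] show ?thesis by simp
  qed
  have orb_all: "c \<cdot> s [^] i \<in> orb c" if "c \<in> cosets" for c and i :: nat
    using mod[OF that, of i] p0 unfolding orb_def by (metis imageI lessThan_iff mod_less_divisor)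
  have orb_sub: "orb c \<subseteq> cosets" if "c \<in> cosets" for c
    using that s by (auto simp: orb_def act_closed)
  have orb_self: "c \<in> orb c" if "c \<in> cosets" for c
    using orb_all[OF that, of 0] act_one[OF that] by simp
  have orb_mem: "orb d \<subseteq> orb c" if d: "d \<in> orb c" and c: "c \<in> cosets" for c d
  proof
    fix e assume "e \<in> orb d"
    then obtain i j where "d = c \<cdot> s [^] (i::nat)" "e = d \<cdot> s [^] (j::nat)"
      using d unfolding orb_def by blast
    then show "e \<in> orb c" using orb_all[OF c, of "i + j"] pow[OF c] by simp
  qed
  have orb_sym: "c \<in> orb d" if d: "d \<in> orb c" and c: "c \<in> cosets" for c d
  proof -
    from d obtain i where i: "i < p ^ k" "d = c \<cdot> s [^] (i::nat)" unfolding orb_def by blast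
    then have "d \<cdot> s [^] (p ^ k - i) = c"
      using pow[OF c, of i "p ^ k - i"] triv[OF c] by simp
    moreover have "d \<in> cosets" using d orb_sub c by blast
    ultimately show ?thesis using orb_all by metis
  qed
  have orb_eq: "orb d = orb c" if "d \<in> orb c" "c \<in> cosets" for c d
    using that orb_mem orb_sym orb_sub by (meson subsetD subset_antisym)
  define Orbs where "Orbs = {orb c |c. c \<in> cosets \<and> card (orb c) = p ^ k}"
  have finO: "finite Orbs"
    unfolding Orbs_def using fin by simp
  define rep where "rep Q = (SOME c. c \<in> Q)" for Q :: "'c set set"
  have rep: "rep (orb c) \<in> orb c" if "c \<in> cosets" for c
    unfolding rep_def using orb_self[OF that] by (rule someI)
  define B where "B = rep ` Orbs"
  \<comment> \<open>The full orbits are disjoint blocks of size \<open>p ^ k\<close> inside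
    \<open>cosets\<close>; this yields the factor \<open>1 / p ^ k\<close> in the count.\<close>
  have "p ^ k * card Orbs = card (\<Union>Orbs)"
  proof (rule card_partition)
    show "finite Orbs" by (rule finO)
    have "\<Union>Orbs \<subseteq> cosets" using orb_sub by (auto simp: Orbs_def)
    then show "finite (\<Union>Orbs)" using fin by (rule finite_subset)
    show "card Q = p ^ k" if "Q \<in> Orbs" for Q using that by (auto simp: Orbs_def)
    show "Q \<inter> Q' = {}" if "Q \<in> Orbs" "Q' \<in> Orbs" "Q \<noteq> Q'" for Q Q'
    proof (rule ccontr)
      assume "Q \<inter> Q' \<noteq> {}"
      then obtain d where d: "d \<in> Q" "d \<in> Q'" by blast
      from that(1) obtain c where c: "c \<in> cosets" "Q = orb c" by (auto simp: Orbs_def)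
      from that(2) obtain c' where c': "c' \<in> cosets" "Q' = orb c'" by (auto simp: Orbs_def)
      show False
        using orb_eq[of d c] orb_eq[of d c'] c c' d that(3) by simp
    qed
  qed
  also have "\<dots> \<le> card cosets"
    using orb_sub fin by (intro card_mono) (auto simp: Orbs_def)
  finally have "p ^ k * card B \<le> card cosets"
    unfolding B_def using mult_le_mono2[OF card_image_le[OF finO, of rep]] by (rule le_trans[rotated])
  moreover have "B \<subseteq> cosets"
    unfolding B_def Orbs_def using rep orb_sub by auto
  moreover have "int p dvd D c (s [^] (p ^ k))"
    if D: "cocycle D" and B: "\<forall>c\<in>B. int p dvd D c (s [^] (p ^ k))" and c: "c \<in> cosets" for D c
  proof (cases "card (orb c) = p ^ k")
    case True
    then have "rep (orb c) \<in> B" using c by (auto simp: B_def Orbs_def)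
    moreover obtain i where "rep (orb c) = c \<cdot> s [^] (i::nat)"
      using rep[OF c] by (auto simp: orb_def)
    ultimately show ?thesis using B cocycle_rotate[OF D c s r] by metis
  next
    case False
    then have "\<not> inj_on (\<lambda>i. c \<cdot> s [^] i) {..<p ^ k}"
      using card_image[of "\<lambda>i. c \<cdot> s [^] i" "{..<p ^ k}"] by (auto simp: orb_def)
    then obtain i j where ij: "i < j" "j < p ^ k" "c \<cdot> s [^] i = c \<cdot> s [^] j"
      using linorder_inj_onI'[of "{..<p ^ k}" "\<lambda>i. c \<cdot> s [^] i"] by blast
    \<comment> \<open>Acting with \<open>s ^ (p ^ k - i)\<close> on the collision of the exponents
      \<open>i\<close> and \<open>j\<close> turns it into the period \<open>j - i\<close> of
      \<open>c\<close>, without negative exponents.\<close>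
    have "c \<cdot> s [^] (j - i) = c \<cdot> s [^] (j - i) \<cdot> s [^] (p ^ k)"
      using triv act_closed[OF c, of "s [^] (j - i)"] s by simp
    also have "\<dots> = c \<cdot> s [^] (j + (p ^ k - i))"
      using pow[OF c, of "j - i" "p ^ k"] ij by simp
    also have "\<dots> = c \<cdot> s [^] (i + (p ^ k - i))"
      unfolding pow[OF c] ij(3) ..
    also have "\<dots> = c" using ij triv[OF c] by simp
    finally show ?thesis
      using cocycle_dvd_of_short_orbit[OF D c s p triv[OF c], of "j - i"] ij by simp
  qed
  ultimately show ?thesis by blast
qed

text \<open>The elements fixing every coset and having \<open>p\<close>-divisible value at every
  coset form a normal subgroup. Asking this at all cosets is what gives normality, because
  conjugation by \<open>x\<close> moves the starting point from \<open>c\<close> to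
  \<open>c \<cdot> x\<close>.\<close>

lemma cocycle_dvd_normal_closure:
  assumes D: "cocycle D" and R: "R \<subseteq> carrier F" "\<And>r. r \<in> R \<Longrightarrow> \<pi> r = \<one>\<^bsub>G\<^esub>"
    and dvd: "\<And>r c. r \<in> R \<Longrightarrow> c \<in> cosets \<Longrightarrow> p dvd D c r"
    and w: "w \<in> normal_closure F R" and c: "c \<in> cosets"
  shows "p dvd D c w"
proof -
  define N where "N = {w \<in> carrier F. \<forall>c\<in>cosets. c \<cdot> w = c \<and> p dvd D c w}"
  have inv: "D c (inv u) = - D c u" "c \<cdot> inv u = c" if "u \<in> N" "c \<in> cosets" for u c
    using that cocycle_inv[OF D, of c u] act_inv[of c u] by (auto simp: N_def)
  have "N \<lhd> F"
    unfolding F.normal_inv_iff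
  proof (intro conjI ballI)
    show "subgroup N F"
    proof (rule F.subgroupI)
      have "\<one> \<in> N" by (simp add: N_def cocycle_one[OF D] act_one del: hm.hom_one)
      then show "N \<noteq> {}" by blast
      show "inv u \<in> N" if "u \<in> N" for u
        using that unfolding N_def by (simp add: inv[OF that] del: hm.hom_inv)
      show "u \<otimes> v \<in> N" if "u \<in> N" "v \<in> N" for u v
      proof -
        have uv: "u \<in> carrier F" "v \<in> carrier F" using that by (auto simp: N_def)
        show ?thesis
          unfolding N_def
        proof (intro CollectI conjI ballI)
          fix c assume c: "c \<in> cosets"
          have "c \<cdot> u = c" "c \<cdot> v = c" "p dvd D c u" "p dvd D c v"
            using that c by (auto simp: N_def)
          then show "c \<cdot> (u \<otimes> v) = c" "p dvd D c (u \<otimes> v)"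
            using act_mult[OF c uv] cocycle_mult[OF D c uv] by simp_all
        qed (use uv in simp)
      qed
    qed (auto simp: N_def)
    fix x u assume x: "x \<in> carrier F" and u: "u \<in> N"
    then have uF: "u \<in> carrier F" by (simp add: N_def)
    show "x \<otimes> u \<otimes> inv x \<in> N"
      unfolding N_def
    proof (intro CollectI conjI ballI)
      fix c assume c: "c \<in> cosets"
      then have cx: "c \<cdot> x \<in> cosets" using x by (rule act_closed)
      then have ux: "c \<cdot> x \<cdot> u = c \<cdot> x" "p dvd D (c \<cdot> x) u" using u by (auto simp: N_def)
      then have cxu: "c \<cdot> (x \<otimes> u) = c \<cdot> x"
        using act_mult[OF c x uF] by simp
      show "c \<cdot> (x \<otimes> u \<otimes> inv x) = c"
        using act_mult[OF c, of "x \<otimes> u" "inv x"] cxu act_inv[OF c x] x uF by simp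
      show "p dvd D c (x \<otimes> u \<otimes> inv x)"
        using cocycle_mult[OF D c, of "x \<otimes> u" "inv x"] cxu cocycle_inv[OF D c x]
          cocycle_mult[OF D c x uF] ux x uF by simp
    qed (use x uF in simp)
  qed
  moreover have "R \<subseteq> N"
    using R dvd by (auto simp: N_def G.rcosets_act_one[OF sub.subgroup_axioms])
  ultimately have "w \<in> N" using w by (auto simp: normal_closure_def)
  then show ?thesis using c by (simp add: N_def)
qed

text \<open>On the preimage of \<open>H\<close> the map \<open>D H\<close> is a homomorphism. Modulo
  \<open>p\<close> it vanishes on the kernel of \<open>\<pi>\<close>, so it descends to
  \<open>H\<close> and is decided by lifts of generators.\<close>

lemma cocycle_dvd_subgroup:
  assumes D: "cocycle D"
    and ker: "\<And>w. w \<in> kernel F G \<pi> \<Longrightarrow> p dvd D H w"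
    and B: "B \<subseteq> H" "generate G B = H"
    and lift: "\<And>b. b \<in> B \<Longrightarrow> l b \<in> carrier F \<and> \<pi> (l b) = b \<and> p dvd D H (l b)"
    and w: "w \<in> carrier F" "\<pi> w \<in> H"
  shows "p dvd D H w"
proof -
  have mult: "D H (u \<otimes> v) = D H u + D H v" if "u \<in> carrier F" "v \<in> carrier F" "\<pi> u \<in> H" for u v
    using cocycle_mult[OF D base that(1,2)] act_base_iff[OF that(1)] that(3) by simp
  have D_inv: "D H (inv u) = - D H u" if "u \<in> carrier F" "\<pi> u \<in> H" for u
    using cocycle_inv[OF D base that(1)] act_base_iff[OF that(1)] that(2) by simp
  have transport: "p dvd D H v" if u: "u \<in> carrier F" "\<pi> u \<in> H" "p dvd D H u"
    and v: "v \<in> carrier F" "\<pi> v = \<pi> u" for u v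
  proof -
    have "inv u \<otimes> v \<in> kernel F G \<pi>"
      using u v by (simp add: kernel_def)
    then have "p dvd D H (inv u \<otimes> v)" by (rule ker)
    also have "D H (inv u \<otimes> v) = D H v - D H u"
      using mult[of "inv u" v] D_inv[of u] u v by simp
    finally show ?thesis using u(3) dvd_add[of p "D H v - D H u" "D H u"] by simp
  qed
  have "\<exists>u\<in>carrier F. \<pi> u = h \<and> p dvd D H u" if "h \<in> generate G B" for h
    using that
  proof induction
    case one
    show ?case using cocycle_one[OF D base] by (intro bexI[of _ \<one>] conjI) simp_all
  next
    case (incl h)
    then show ?case using lift[of h] by (intro bexI[of _ "l h"]) auto
  next
    case (inv h)
    have "l h \<in> carrier F" "\<pi> (l h) = h" "p dvd D H (l h)" "h \<in> H"
      using lift[OF inv] inv B(1) by auto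
    then show ?case
      using D_inv[of "l h"] by (intro bexI[of _ "inv (l h)"] conjI) simp_all
  next
    case (eng h k)
    then obtain u v where "u \<in> carrier F" "\<pi> u = h" "p dvd D H u"
      "v \<in> carrier F" "\<pi> v = k" "p dvd D H v" by blast
    then show ?case
      using mult[of u v] eng(1) B(2) by (intro bexI[of _ "u \<otimes> v"] conjI) simp_all
  qed
  then obtain u where u: "u \<in> carrier F" "\<pi> w = \<pi> u" "p dvd D H u"
    using w(2) unfolding B(2) by metis
  have "\<pi> u \<in> H" using w(2) u(2) by simp
  then show ?thesis by (rule transport[OF u(1) _ u(3) w(1) u(2)])
qed

end

section \<open>Path sums in the Schreier graph\<close>

lemma reduced_Cons_mult:
  assumes "a # w \<in> carrier (free_group X)"
  shows "[a] \<in> carrier (free_group X)" "w \<in> carrier (free_group X)"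
    "[a] \<otimes>\<^bsub>free_group X\<^esub> w = a # w"
  using assms reduce_reduced[of "a # w"]
  by (auto simp: free_group_def reduced_def dest: reduced_ConsD[unfolded reduced_def])

text \<open>\<open>T\<close> moves along letters and \<open>f\<close> labels edges by starting
  vertex and generator. An inverse letter runs backwards along the edge that starts at the vertex
  being reached, hence the sign and the argument \<open>T c a\<close>.\<close>

fun path_sum :: "('c \<Rightarrow> 'x \<times> bool \<Rightarrow> 'c) \<Rightarrow> ('c \<times> 'x \<Rightarrow> int) \<Rightarrow> 'c \<Rightarrow> 'x word \<Rightarrow> int" where
  "path_sum T f c [] = 0"
| "path_sum T f c (a # w) =
    (if snd a then f (c, fst a) else - f (T c a, fst a)) + path_sum T f (T c a) w"

lemma path_sum_diff:
  "path_sum T (\<lambda>e. f e - g e) c w = path_sum T f c w - path_sum T g c w"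
  by (induction w arbitrary: c) auto

text \<open>A cancelled pair of letters crosses the same edge forth and back and contributes 0,
  provided that the second step returns to \<open>c\<close>.\<close>

lemma path_sum_cons_red:
  assumes "T (T c a) (flip a) = c"
  shows "path_sum T f c (cons_red a w) = path_sum T f c (a # w)"
  using assms by (cases w) (auto simp: flip_def)

locale free_coset_hom = coset_hom "free_group X" G H \<pi>
  for X :: "'x set" and G (structure) and H \<pi>
begin

abbreviation step where "step c a \<equiv> c \<cdot> [a]"

abbreviation psum where "psum \<equiv> path_sum (\<lambda>c a. step c a)"

lemma letter: "fst a \<in> X \<Longrightarrow> [a] \<in> carrier (free_group X)"
  by (simp add: free_group_def reduced_def)

lemma step_closed: "\<lbrakk>c \<in> cosets; fst a \<in> X\<rbrakk> \<Longrightarrow> step c a \<in> cosets"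
  by (simp add: act_closed letter)

lemma step_flip:
  assumes "c \<in> cosets" "fst a \<in> X"
  shows "step (step c a) (flip a) = c"
proof -
  have "[a] \<otimes>\<^bsub>free_group X\<^esub> [flip a] = \<one>\<^bsub>free_group X\<^esub>"
    by (simp add: free_group_def reduce_def)
  then show ?thesis
    using act_mult[of c "[a]" "[flip a]"] assms letter[of a] letter[of "flip a"] act_one[of c] by simp
qed

lemma act_word: "\<lbrakk>c \<in> cosets; w \<in> carrier (free_group X)\<rbrakk> \<Longrightarrow> foldl step c w = c \<cdot> w"
proof (induction w arbitrary: c)
  case Nil
  then show ?case using act_one[of c] by (simp add: free_group_def)
next
  case (Cons a w)
  note aw = reduced_Cons_mult[OF Cons.prems(2)]
  have "foldl step c (a # w) = step c a \<cdot> w"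
    using Cons.IH[OF act_closed[OF Cons.prems(1) aw(1)] aw(2)] by simp
  also have "\<dots> = c \<cdot> (a # w)"
    using act_mult[OF Cons.prems(1) aw(1,2)] unfolding aw(3) by simp
  finally show ?case .
qed

lemma psum_foldr:
  assumes "c \<in> cosets" "fst ` set u \<subseteq> X"
  shows "psum f c (foldr cons_red u v) = psum f c u + psum f (foldl step c u) v"
  using assms
proof (induction u arbitrary: c)
  case (Cons a u)
  then have a: "fst a \<in> X" by simp
  show ?case
    using Cons step_closed[OF Cons.prems(1) a]
      path_sum_cons_red[where T = "\<lambda>c a. step c a", OF step_flip[OF Cons.prems(1) a]]
    by simp
qed simp

lemma psum_cocycle: "cocycle (psum f)"
  unfolding cocycle_def
proof (intro ballI)
  fix c u v
  assume c: "c \<in> cosets" and u: "u \<in> carrier (free_group X)" and v: "v \<in> carrier (free_group X)"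
  have "u \<otimes>\<^bsub>free_group X\<^esub> v = foldr cons_red u v"
    using v by (simp add: free_group_def reduce_append)
  then show "psum f c (u \<otimes>\<^bsub>free_group X\<^esub> v) = psum f c u + psum f (c \<cdot> u) v"
    using psum_foldr[OF c, of u f v] act_word[OF c u] u by (simp add: free_group_def)
qed

text \<open>The labellings of the edges of the Schreier graph of \<open>H\<close> by residues mod \<open>p\<close> are separated
  by their path sums along lifts of generators of \<open>H\<close>, along a transversal, and along the
  relators; comparing cardinalities bounds the number of generators from below.\<close>

lemma generators_lower_bound:
  assumes X: "finite X" and fin: "finite cosets" and p: "prime p"
    and surj: "\<pi> ` carrier (free_group X) = carrier G"
    and R: "R \<subseteq> carrier (free_group X)"
    and ker: "kernel (free_group X) G \<pi> = normal_closure (free_group X) R"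
    and B: "B \<subseteq> H" "finite B" "generate G B = H"
    and finC: "finite (SIGMA r:R. C r)"
    and C: "\<And>r D. \<lbrakk>r \<in> R; cocycle D; \<forall>c\<in>C r. int p dvd D c r\<rbrakk> \<Longrightarrow> \<forall>c\<in>cosets. int p dvd D c r"
  shows "card cosets * card X + 1 \<le> card B + card cosets + card (SIGMA r:R. C r)"
proof -
  have "\<forall>g\<in>carrier G. \<exists>w\<in>carrier (free_group X). \<pi> w = g"
    using surj by (metis imageE)
  then obtain l where l: "l g \<in> carrier (free_group X)" "\<pi> (l g) = g" if "g \<in> carrier G" for g
    by metis
  have "\<exists>w\<in>carrier (free_group X). H \<cdot> w = c" if "c \<in> cosets" for c
  proof -
    from that obtain a where "a \<in> carrier G" "c = H #> a" by (auto simp: RCOSETS_def)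
    then show ?thesis using l[of a] by (intro bexI[of _ "l a"]) simp_all
  qed
  then obtain \<tau> where \<tau>: "\<tau> c \<in> carrier (free_group X)" "H \<cdot> \<tau> c = c" if "c \<in> cosets" for c
    by metis
  \<comment> \<open>The measurements of a labelling: one per generator of \<open>H\<close>, one per
    coset other than \<open>H\<close>, and the conditions of the relators. Leaving out
    \<open>H\<close> saves the 1 that becomes the \<open>- 1\<close> in
    \<open>d(H) - 1\<close>.\<close>
  define J where "J = (\<lambda>b. (H, l b)) ` B \<union> (\<lambda>c. (H, \<tau> c)) ` (cosets - {H})
    \<union> (\<lambda>(r, c). (c, r)) ` (SIGMA r:R. C r)"
  have finJ: "finite J" using B fin finC by (simp add: J_def)
  have "card J \<le> card ((\<lambda>b. (H, l b)) ` B) + card ((\<lambda>c. (H, \<tau> c)) ` (cosets - {H}))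
    + card ((\<lambda>(r, c). (c, r)) ` (SIGMA r:R. C r))"
    unfolding J_def by (meson add_le_mono1 card_Un_le le_trans)
  also have "\<dots> \<le> card B + card (cosets - {H}) + card (SIGMA r:R. C r)"
    using B fin finC by (intro add_mono card_image_le) auto
  also have "\<dots> + 1 = card B + card cosets + card (SIGMA r:R. C r)"
    using base fin card_gt_0_iff[of cosets] by (auto simp: card_Diff_singleton)
  finally have cardJ: "card J + 1 \<le> card B + card cosets + card (SIGMA r:R. C r)" by simp
  have R1: "\<pi> r = \<one>" if "r \<in> R" for r
  proof -
    have "r \<in> normal_closure (free_group X) R"
      using that by (auto simp: normal_closure_def)
    then show ?thesis unfolding ker[symmetric] by (simp add: kernel_def)
  qed
  \<comment> \<open>If all measurements vanish mod \<open>p\<close>, so do all labels. This is the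
    kernel of the measurement map, from which injectivity follows by linearity.\<close>
  have edge: "int p dvd f (c, x)"
    if J: "\<And>c w. (c, w) \<in> J \<Longrightarrow> int p dvd psum f c w" and c: "c \<in> cosets" and x: "x \<in> X"
    for f c x
  proof -
    let ?D = "psum f"
    note D = psum_cocycle[of f]
    have rel: "int p dvd ?D c r" if "r \<in> R" "c \<in> cosets" for r c
      using C[OF that(1) D] J that by (force simp: J_def)
    have kerD: "int p dvd ?D H w" if "w \<in> kernel (free_group X) G \<pi>" for w
      using cocycle_dvd_normal_closure[OF D R R1 rel _ base] that unfolding ker by blast
    have sub: "int p dvd ?D H w" if w: "w \<in> carrier (free_group X)" "\<pi> w \<in> H" for w
    proof (rule cocycle_dvd_subgroup[OF D kerD B(1,3) _ w])
      show "l b \<in> carrier (free_group X) \<and> \<pi> (l b) = b \<and> int p dvd ?D H (l b)" if "b \<in> B" for b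
        using that l[of b] J[of H "l b"] B(1) sub.subset by (auto simp: J_def)
    qed
    have tau: "int p dvd ?D H (\<tau> c)" if "c \<in> cosets" for c
    proof (cases "c = H")
      \<comment> \<open>The word \<open>\<tau> H\<close> may be nonempty, but its image lies in
        \<open>H\<close>.\<close>
      case True
      then show ?thesis using sub[of "\<tau> c"] \<tau>[OF that] act_base_iff[of "\<tau> c"] by simp
    next
      case False
      then show ?thesis using J[of H "\<tau> c"] that by (simp add: J_def)
    qed
    have all: "int p dvd ?D H u" if u: "u \<in> carrier (free_group X)" for u
    proof -
      \<comment> \<open>Here \<open>u\<close> factors as a word mapping into \<open>H\<close>
        followed by \<open>\<tau> c\<close>, where \<open>c\<close> is the endpoint of
        \<open>u\<close> from \<open>H\<close>.\<close>
      define c where "c = H \<cdot> u"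
      have c: "c \<in> cosets" unfolding c_def by (rule act_closed[OF base u])
      let ?i = "inv\<^bsub>free_group X\<^esub> (\<tau> c)" and ?v = "u \<otimes>\<^bsub>free_group X\<^esub> inv\<^bsub>free_group X\<^esub> (\<tau> c)"
      have i: "?i \<in> carrier (free_group X)" using \<tau>(1)[OF c] by simp
      have v: "?v \<in> carrier (free_group X)" using u i by simp
      have "H \<cdot> ?v = H"
        using act_mult[OF base u i] act_inv[OF base \<tau>(1)[OF c]] \<tau>(2)[OF c] c_def by metis
      then have "int p dvd ?D H ?v" using sub[OF v] act_base_iff[OF v] by blast
      moreover have "?D H ?v = ?D H u - ?D H (\<tau> c)"
        using cocycle_mult[OF D base u i] cocycle_inv[OF D base \<tau>(1)[OF c]] \<tau>(2)[OF c]
        unfolding c_def by simp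
      ultimately have "int p dvd ?D H u - ?D H (\<tau> c)" by simp
      then show ?thesis using tau[OF c] dvd_diff_left_iff by blast
    qed
    \<comment> \<open>The label of the edge \<open>(c, x)\<close> is the difference of two path sums
      from \<open>H\<close>: along \<open>\<tau> c\<close> followed by \<open>x\<close>, and along
      \<open>\<tau> c\<close>.\<close>
    have x': "[(x, True)] \<in> carrier (free_group X)" using letter x by simp
    have "?D H (\<tau> c \<otimes>\<^bsub>free_group X\<^esub> [(x, True)]) = ?D H (\<tau> c) + ?D c [(x, True)]"
      using cocycle_mult[OF D base \<tau>(1)[OF c] x'] \<tau>(2)[OF c] by metis
    moreover have "?D c [(x, True)] = f (c, x)" by simp
    ultimately show ?thesis
      using all[of "\<tau> c \<otimes>\<^bsub>free_group X\<^esub> [(x, True)]"] tau[OF c] \<tau>(1)[OF c] x'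
      by (metis F.m_closed dvd_add_right_iff)
  qed
  define L where "L f = restrict (\<lambda>(c, w). psum f c w mod int p) J" for f
  let ?\<Phi> = "PiE (cosets \<times> X) (\<lambda>_. {0..<int p})"
  have p0: "int p > 0" using p by (simp add: prime_gt_0_nat)
  have "inj_on L ?\<Phi>"
  proof (rule inj_onI)
    fix f g assume f: "f \<in> ?\<Phi>" and g: "g \<in> ?\<Phi>" and eq: "L f = L g"
    have J: "int p dvd psum (\<lambda>e. f e - g e) c w" if "(c, w) \<in> J" for c w
      using fun_cong[OF eq, of "(c, w)"] that
      by (simp add: L_def path_sum_diff mod_eq_dvd_iff)
    show "f = g"
    proof (rule PiE_ext[OF f g])
      fix e assume e: "e \<in> cosets \<times> X"
      then have "int p dvd f e - g e"
        using edge[of "\<lambda>e. f e - g e", OF J] by auto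
      then have "f e mod int p = g e mod int p" by (simp add: mod_eq_dvd_iff)
      moreover have "f e \<in> {0..<int p}" "g e \<in> {0..<int p}" using f g e by auto
      ultimately show "f e = g e" by simp
    qed
  qed
  moreover have "L ` ?\<Phi> \<subseteq> PiE J (\<lambda>_. {0..<int p})"
    using p0 by (auto simp: L_def)
  ultimately have "card ?\<Phi> \<le> card (PiE J (\<lambda>_. {0..<int p}))"
    using finJ by (intro card_inj_on_le[of L]) (auto intro: finite_PiE)
  then have "p ^ (card cosets * card X) \<le> p ^ card J"
    using X fin finJ by (simp add: card_PiE card_cartesian_product)
  then have "card cosets * card X \<le> card J"
    using p prime_gt_1_nat power_le_imp_le_exp by blast
  then show ?thesis using cardJ by simp
qed

text \<open>If \<open>r\<close> is a \<open>p ^ k\<close>-th power for unboundedly many \<open>k\<close> then \<open>nu p X r\<close> is a junk value, but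
  then no orbit is long enough for \<open>r\<close> to impose a condition.\<close>

lemma relator_conditions:
  assumes fin: "finite cosets" and p: "prime p" and r: "r \<in> carrier (free_group X)" "\<pi> r = \<one>"
  shows "\<exists>B\<subseteq>cosets. real (card B) \<le> real (card cosets) * (1 / real p ^ nu p X r) \<and>
    (\<forall>D. cocycle D \<longrightarrow> (\<forall>c\<in>B. int p dvd D c r) \<longrightarrow> (\<forall>c\<in>cosets. int p dvd D c r))"
proof -
  let ?P = "\<lambda>k. \<exists>s\<in>carrier (free_group X). r = s [^]\<^bsub>free_group X\<^esub> (p ^ k)"
  have P0: "?P 0" using r by (intro bexI[of _ r]) simp_all
  have cond: "\<exists>B\<subseteq>cosets. p ^ k * card B \<le> card cosets \<and>
    (\<forall>D. cocycle D \<longrightarrow> (\<forall>c\<in>B. int p dvd D c r) \<longrightarrow> (\<forall>c\<in>cosets. int p dvd D c r))"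
    if "?P k" for k
  proof -
    from that obtain s where s: "s \<in> carrier (free_group X)" "r = s [^]\<^bsub>free_group X\<^esub> (p ^ k)" by blast
    show ?thesis
      using power_relator_conditions[OF fin p s(1), of k] r(2) unfolding s(2) by simp
  qed
  show ?thesis
  proof (cases "\<exists>b. \<forall>k. ?P k \<longrightarrow> k \<le> b")
    case True
    then obtain b where "\<forall>k. ?P k \<longrightarrow> k \<le> b" by blast
    then have "?P (nu p X r)"
      unfolding nu_def using P0 by (intro GreatestI_nat[of ?P 0 b]) auto
    from cond[OF this] obtain B where B: "B \<subseteq> cosets" "p ^ nu p X r * card B \<le> card cosets"
      "\<forall>D. cocycle D \<longrightarrow> (\<forall>c\<in>B. int p dvd D c r) \<longrightarrow> (\<forall>c\<in>cosets. int p dvd D c r)"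
      by blast
    have "real (p ^ nu p X r * card B) \<le> real (card cosets)" using B(2) by (rule of_nat_mono)
    then have "real (card B) \<le> real (card cosets) * (1 / real p ^ nu p X r)"
      using p by (simp add: field_simps prime_gt_0_nat)
    then show ?thesis using B(1,3) by blast
  next
    case False
    \<comment> \<open>For such \<open>k\<close> already \<open>p ^ k > card cosets\<close>, so the
      set of conditions is empty and meets the bound whatever \<open>nu p X r\<close> is.\<close>
    then obtain k where k: "?P k" "\<not> k \<le> card cosets" by metis
    from cond[OF k(1)] obtain B where B: "B \<subseteq> cosets" "p ^ k * card B \<le> card cosets"
      "\<forall>D. cocycle D \<longrightarrow> (\<forall>c\<in>B. int p dvd D c r) \<longrightarrow> (\<forall>c\<in>cosets. int p dvd D c r)"
      by blast
    have "card cosets < p ^ k"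
      using k(2) power_gt_expt[of p k] prime_gt_1_nat[OF p] by simp
    then have "card B = 0" using B(2) by (cases "card B") auto
    then show ?thesis using B(1,3) by (intro exI[of _ B]) simp
  qed
qed

end

text \<open>Each relator with a condition adds at least 1 to the count, while all finite partial
  counts stay below the index times the convergent sum. Hence only finitely many relators
  contribute, even if \<open>R\<close> is infinite.\<close>

lemma (in free_coset_hom) sum_conditions_le:
  assumes fin: "finite cosets" and p: "prime p"
    and C: "\<And>r. r \<in> R \<Longrightarrow> C r \<subseteq> cosets"
    and S: "S \<subseteq> R" "(\<lambda>r. 1 / real p ^ nu p X r) summable_on S"
    and le: "\<And>r. r \<in> S \<Longrightarrow> real (card (C r)) \<le> real (card cosets) * (1 / real p ^ nu p X r)"
    and nil: "\<And>r. r \<in> R - S \<Longrightarrow> C r = {}"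
  shows "finite (SIGMA r:R. C r)"
    and "real (card (SIGMA r:R. C r)) \<le> real (card cosets) * (\<Sum>\<^sub>\<infinity>r\<in>S. 1 / real p ^ nu p X r)"
proof -
  define Z where "Z = {r \<in> S. C r \<noteq> {}}"
  have ZR: "(SIGMA r:R. C r) = (SIGMA r:Z. C r)"
    using S(1) nil by (auto simp: Z_def)
  have finC: "finite (C r)" if "r \<in> Z" for r
  proof (rule finite_subset[OF C fin])
    show "r \<in> R" using that S(1) by (auto simp: Z_def)
  qed
  let ?s = "\<lambda>A. \<Sum>r\<in>A. real (card (C r))"
  let ?b = "real (card cosets) * (\<Sum>\<^sub>\<infinity>r\<in>S. 1 / real p ^ nu p X r)"
  have bound: "?s Y \<le> ?b" if Y: "Y \<subseteq> Z" "finite Y" for Y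
  proof -
    have "?s Y \<le> (\<Sum>r\<in>Y. real (card cosets) * (1 / real p ^ nu p X r))"
      using Y by (intro sum_mono le) (auto simp: Z_def)
    also have "\<dots> = real (card cosets) * (\<Sum>r\<in>Y. 1 / real p ^ nu p X r)"
      by (simp only: sum_distrib_left)
    also have "\<dots> \<le> ?b"
      using S(2) Y by (intro mult_left_mono finite_sum_le_infsum) (auto simp: Z_def)
    finally show ?thesis .
  qed
  have "finite Z"
  proof -
    have "card Y \<le> nat \<lfloor>?b\<rfloor>" if Y: "Y \<subseteq> Z" "finite Y" for Y
    proof -
      have "1 \<le> card (C r)" if "r \<in> Y" for r
        using that Y(1) finC[of r] by (auto simp: Z_def Suc_le_eq card_gt_0_iff)
      then have "real (card Y) \<le> ?s Y"
        using sum_mono[of Y "\<lambda>_. 1" "\<lambda>r. real (card (C r))"] by simp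
      then show ?thesis using bound[OF Y] by (simp add: le_nat_floor)
    qed
    then show ?thesis using finite_if_finite_subsets_card_bdd by blast
  qed
  then show "finite (SIGMA r:R. C r)"
    unfolding ZR using finC by (rule finite_SigmaI)
  show "real (card (SIGMA r:R. C r)) \<le> ?b"
    unfolding ZR using bound[of Z] \<open>finite Z\<close> finC by (simp add: card_SigmaI)
qed

section \<open>A lower bound for the rank gradient from the p-deficiency\<close>

theorem theorem2p4:
  fixes p n :: nat
    and X :: "'x set"
    and R S1 S2 S3 :: "'x word set"
    and G :: "('g, 'b) monoid_scheme"
    and \<pi> :: "'x word \<Rightarrow> 'g"
  assumes "prime p"
    and "group G" and "finitely_generated G"
    and "finite X" and "card X = n" and "n \<ge> 2"
    and "presents X R G \<pi>"
    and "R = S1 \<union> S2 \<union> S3"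
    and "S1 \<inter> S2 = {}" and "S1 \<inter> S3 = {}" and "S2 \<inter> S3 = {}"
    and "finite S1"
    and "\<forall>w\<in>S1. \<not> (\<exists>s\<in>carrier (free_group X). w = s [^]\<^bsub>free_group X\<^esub> p)"
    and "\<forall>w\<in>S2. \<exists>v\<in>carrier (free_group X). \<exists>a>0.
           w = v [^]\<^bsub>free_group X\<^esub> (p ^ a) \<and> residual_ord G (\<pi> v) = p ^ a"
    and "\<forall>w\<in>S3. \<exists>u\<in>carrier (free_group X). \<exists>b>0.
           w = u [^]\<^bsub>free_group X\<^esub> (p ^ b) \<and>
           0 < residual_ord G (\<pi> u) \<and> residual_ord G (\<pi> u) < p ^ b"
    and "p_deficiency p X (S1 \<union> S2) > 1"
  shows "rank_gradient G > 0"
proof -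
  let ?F = "free_group X" and ?S = "S1 \<union> S2"
  note p = \<open>prime p\<close>
  interpret F: group ?F by (rule group_free_group)
  interpret G: group G by fact
  have R: "R \<subseteq> carrier ?F" and hom: "\<pi> \<in> hom ?F G" and surj: "\<pi> ` carrier ?F = carrier G"
    and ker: "kernel ?F G \<pi> = normal_closure ?F R"
    using \<open>presents X R G \<pi>\<close> by (auto simp: presents_def)
  have R1: "\<pi> r = \<one>\<^bsub>G\<^esub>" if "r \<in> R" for r
  proof -
    have "r \<in> normal_closure ?F R" using that by (auto simp: normal_closure_def)
    then show ?thesis unfolding ker[symmetric] by (simp add: kernel_def)
  qed
  let ?\<sigma> = "\<Sum>\<^sub>\<infinity>r\<in>?S. 1 / real p ^ nu p X r"
  \<comment> \<open>A divergent sum would make the deficiency \<open>-\<infinity>\<close>,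
    contradicting that it exceeds 1.\<close>
  have summable: "(\<lambda>r. 1 / real p ^ nu p X r) summable_on ?S"
    and def: "real n - ?\<sigma> > 1"
    using \<open>p_deficiency p X ?S > 1\<close> \<open>card X = n\<close>
    by (auto simp: p_deficiency_def one_ereal_def split: if_splits)
  have bound: "real n - ?\<sigma> - 1 \<le>
      (real (min_gens (G\<lparr>carrier := H\<rparr>)) - 1) / real (card (rcosets\<^bsub>G\<^esub> H))"
    if index: "finite_index_subgroup H G" for H
  proof -
    from index have H: "subgroup H G" and fin: "finite (rcosets\<^bsub>G\<^esub> H)"
      by (auto simp: finite_index_subgroup_def)
    interpret free_coset_hom X G H \<pi>
      using F.is_group G.is_group H hom by (simp add: free_coset_hom_def coset_hom_def coset_hom_axioms_def)
    obtain B where B: "B \<subseteq> H" "finite B" "generate G B = H"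
      "card B = min_gens (G\<lparr>carrier := H\<rparr>)"
      using G.min_gens_attained[OF \<open>finitely_generated G\<close> H fin] .
    have "\<forall>r\<in>?S. \<exists>C\<subseteq>cosets. real (card C) \<le> real (card cosets) * (1 / real p ^ nu p X r) \<and>
      (\<forall>D. cocycle D \<longrightarrow> (\<forall>c\<in>C. int p dvd D c r) \<longrightarrow> (\<forall>c\<in>cosets. int p dvd D c r))"
      (is "\<forall>r\<in>_. ?Q r")
    proof
      fix r assume "r \<in> ?S"
      then have "r \<in> R" using \<open>R = S1 \<union> S2 \<union> S3\<close> by auto
      then show "?Q r" by (intro relator_conditions[OF fin p] subsetD[OF R] R1)
    qed
    from bchoice[OF this] obtain C where C: "\<And>r. r \<in> ?S \<Longrightarrow> C r \<subseteq> cosets"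
      "\<And>r. r \<in> ?S \<Longrightarrow> real (card (C r)) \<le> real (card cosets) * (1 / real p ^ nu p X r)"
      "\<And>r D. \<lbrakk>r \<in> ?S; cocycle D; \<forall>c\<in>C r. int p dvd D c r\<rbrakk> \<Longrightarrow> \<forall>c\<in>cosets. int p dvd D c r"
      by metis
    define C' where "C' r = (if r \<in> ?S then C r else {})" for r
    have fin': "finite (SIGMA r:R. C' r)"
      and sum': "real (card (SIGMA r:R. C' r)) \<le> real (card cosets) * ?\<sigma>"
      using sum_conditions_le[OF fin p, of R C' ?S] C(1,2) summable \<open>R = S1 \<union> S2 \<union> S3\<close>
      by (auto simp: C'_def)
    have "\<forall>c\<in>cosets. int p dvd D c r"
      if r: "r \<in> R" and D: "cocycle D" and dvd: "\<forall>c\<in>C' r. int p dvd D c r" for r D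
    proof (cases "r \<in> ?S")
      case True
      then show ?thesis using C(3)[OF True D] dvd by (simp add: C'_def)
    next
      case False
      then have "r \<in> S3" using r \<open>R = S1 \<union> S2 \<union> S3\<close> by blast
      then obtain u b where u: "u \<in> carrier ?F" "r = u [^]\<^bsub>?F\<^esub> (p ^ b)"
        "0 < residual_ord G (\<pi> u)" "residual_ord G (\<pi> u) < p ^ b"
        using assms(15) by blast
      show ?thesis
      proof
        fix c assume c: "c \<in> cosets"
        show "int p dvd D c r"
          unfolding u(2)
        proof (rule cocycle_dvd_of_short_orbit[OF D c u(1) p _ u(3,4)])
          show "c \<cdot> u [^]\<^bsub>?F\<^esub> (p ^ b) = c"
            using R1[OF r] act_one[OF c] unfolding u(2) by simp
          show "c \<cdot> u [^]\<^bsub>?F\<^esub> residual_ord G (\<pi> u) = c"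
            using G.residual_ord_fixes_rcosets[OF index _ c, of "\<pi> u"] u(1)
            by (simp add: hm.hom_nat_pow)
        qed
      qed
    qed
    then have "card cosets * card X + 1 \<le> card B + card cosets + card (SIGMA r:R. C' r)"
      by (rule generators_lower_bound[OF \<open>finite X\<close> fin p surj R ker B(1-3) fin'])
    then have "card cosets * n + 1 \<le> card B + card cosets + card (SIGMA r:R. C' r)"
      unfolding \<open>card X = n\<close> .
    then have "real (card cosets * n + 1) \<le> real (card B + card cosets + card (SIGMA r:R. C' r))"
      by (rule of_nat_mono)
    then have "real (card cosets) * real n + 1 \<le>
        real (card B) + real (card cosets) + real (card cosets) * ?\<sigma>"
      using sum' by simp
    then have "real (card cosets) * (real n - ?\<sigma> - 1) \<le> real (card B) - 1"
      by (simp add: algebra_simps)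
    moreover have "card cosets > 0" using base fin by (auto simp: card_gt_0_iff)
    ultimately show ?thesis
      unfolding B(4) by (simp add: pos_le_divide_eq mult.commute)
  qed
  \<comment> \<open>The bound is independent of \<open>H\<close>, and \<open>G\<close> itself has
    finite index, so it passes to an infimum over a nonempty set.\<close>
  have "real n - ?\<sigma> - 1 \<le> rank_gradient G"
    unfolding rank_gradient_def
    using bound G.finite_index_carrier by (intro cINF_greatest) auto
  then show ?thesis using def by simp
qed

end
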